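(* Suppose $H$ is a residually (bounded torsion) group which has an abelian subgroup that is not bounded torsion. If either $H$ is a torsion group, or $|H| < 2^{\aleph_0}$, then $H$ is not ui.
   Context: A group $K$ is bounded torsion if there exists an integer $n \geq 1$ such that $g^n = 1$ for all $g \in K$. A group $H$ is residually (bounded torsion) if for every $g \in H \setminus \{1\}$ there exists a normal subgroup $L \unlhd H$ with $g \notin L$ and $H/L$ bounded torsion. The ultraproduct $\prod_{n \in \mathbb{N}} G_n/\mathcal{U}$ of groups by an ultrafilter $\mathcal{U}$ on $\mathbb{N}$ is the quotient of $\prod_{n \in \mathbb{N}} G_n$ by the normal subgroup $\{(g_n)_{n} \mid \{n \in \mathbb{N} \mid g_n = 1\} \in \mathcal{U}\}$. A group $H$ is ui if there exist a sequence of groups $\{G_n\}_{n \in \mathbb{N}}$, a nonprincipal ultrafilter $\mathcal{U}$ on $\mathbb{N}$ and a surjective homomorphism from $\prod_{n \in \mathbb{N}} G_n/\mathcal{U}$ onto $H$. *)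

theory Defs
  imports "HOL-Algebra.Algebra" "HOL-Library.Equipollence"
begin

definition bounded_torsion :: "('a, 'm) monoid_scheme \<Rightarrow> bool" where
  "bounded_torsion K \<longleftrightarrow> (\<exists>n::nat. n \<ge> 1 \<and> (\<forall>g\<in>carrier K. g [^]\<^bsub>K\<^esub> n = \<one>\<^bsub>K\<^esub>))"

definition torsion :: "('a, 'm) monoid_scheme \<Rightarrow> bool" where
  "torsion K \<longleftrightarrow> (\<forall>g\<in>carrier K. \<exists>n::nat. n \<ge> 1 \<and> g [^]\<^bsub>K\<^esub> n = \<one>\<^bsub>K\<^esub>)"

definition residually_bounded_torsion :: "('a, 'm) monoid_scheme \<Rightarrow> bool" where
  "residually_bounded_torsion H \<longleftrightarrow>
     (\<forall>g\<in>carrier H - {\<one>\<^bsub>H\<^esub>}. \<exists>L. L \<lhd> H \<and> g \<notin> L \<and> bounded_torsion (H Mod L))"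

definition ultrafilter :: "'i filter \<Rightarrow> bool" where
  "ultrafilter U \<longleftrightarrow> U \<noteq> bot \<and> (\<forall>P. eventually P U \<or> eventually (\<lambda>i. \<not> P i) U)"

definition nonprincipal :: "'i filter \<Rightarrow> bool" where
  "nonprincipal U \<longleftrightarrow> (\<nexists>i. U = principal {i})"

text \<open>For a filter \<open>U\<close>, \<open>eventually P U\<close> says that the set of all \<open>n\<close> with \<open>P n\<close> belongs to \<open>U\<close>.\<close>

definition ultraproduct_kernel ::
  "(nat \<Rightarrow> ('g, 'm) monoid_scheme) \<Rightarrow> nat filter \<Rightarrow> (nat \<Rightarrow> 'g) set" where
  "ultraproduct_kernel G U =
     {g \<in> carrier (product_group UNIV G). eventually (\<lambda>n. g n = \<one>\<^bsub>G n\<^esub>) U}"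

definition ultraproduct ::
  "(nat \<Rightarrow> ('g, 'm) monoid_scheme) \<Rightarrow> nat filter \<Rightarrow> (nat \<Rightarrow> 'g) set monoid" where
  "ultraproduct G U = product_group UNIV G Mod ultraproduct_kernel G U"

lemma ultraproduct_kernel_normal:
  assumes "\<And>n. group (G n)"
  shows "ultraproduct_kernel G U \<lhd> product_group UNIV G"
proof -
  interpret P: group "product_group UNIV G"
    using assms by simp
  have inv: "inv\<^bsub>product_group UNIV G\<^esub> x = (\<lambda>n. inv\<^bsub>G n\<^esub> x n)"
    if "x \<in> carrier (product_group UNIV G)" for x
    using that assms by (simp add: restrict_def)
  show ?thesis
  proof (rule P.normal_invI)
    show "subgroup (ultraproduct_kernel G U) (product_group UNIV G)"
    proof (rule P.subgroupI)
      show "ultraproduct_kernel G U \<noteq> {}"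
        unfolding ultraproduct_kernel_def using P.one_closed
        by (auto intro!: exI[of _ "\<lambda>n. \<one>\<^bsub>G n\<^esub>"])
    next
      fix a assume a: "a \<in> ultraproduct_kernel G U"
      then have "eventually (\<lambda>n. inv\<^bsub>G n\<^esub> a n = \<one>\<^bsub>G n\<^esub>) U"
        unfolding ultraproduct_kernel_def
        by (auto elim!: eventually_mono simp: assms group.is_monoid monoid.inv_one)
      moreover have "a \<in> carrier (product_group UNIV G)"
        using a by (simp add: ultraproduct_kernel_def restrict_def)
      ultimately show "inv\<^bsub>product_group UNIV G\<^esub> a \<in> ultraproduct_kernel G U"
        using P.inv_closed[of a] inv[of a] by (simp add: ultraproduct_kernel_def restrict_def)
    next
      fix a b assume a: "a \<in> ultraproduct_kernel G U" and b: "b \<in> ultraproduct_kernel G U"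
      then have "eventually (\<lambda>n. a n = \<one>\<^bsub>G n\<^esub> \<and> b n = \<one>\<^bsub>G n\<^esub>) U"
        by (simp add: ultraproduct_kernel_def eventually_conj)
      then have "eventually (\<lambda>n. a n \<otimes>\<^bsub>G n\<^esub> b n = \<one>\<^bsub>G n\<^esub>) U"
        by (rule eventually_mono) (simp add: assms group.is_monoid monoid.l_one monoid.one_closed)
      then show "a \<otimes>\<^bsub>product_group UNIV G\<^esub> b \<in> ultraproduct_kernel G U"
        using a b P.m_closed[of a b] by (simp add: ultraproduct_kernel_def restrict_def)
    qed (auto simp: ultraproduct_kernel_def restrict_def)
  next
    fix x h assume h: "h \<in> ultraproduct_kernel G U" and x: "x \<in> carrier (product_group UNIV G)"
    have xn: "x n \<in> carrier (G n)" for n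
      using x by auto
    have hc: "h \<in> carrier (product_group UNIV G)"
      and he: "eventually (\<lambda>n. h n = \<one>\<^bsub>G n\<^esub>) U"
      using h by (auto simp: ultraproduct_kernel_def restrict_def)
    from he have "eventually (\<lambda>n. x n \<otimes>\<^bsub>G n\<^esub> h n \<otimes>\<^bsub>G n\<^esub> inv\<^bsub>G n\<^esub> x n = \<one>\<^bsub>G n\<^esub>) U"
      by (rule eventually_mono)
        (simp add: xn assms group.is_monoid monoid.r_one group.r_inv)
    moreover have "x \<otimes>\<^bsub>product_group UNIV G\<^esub> h \<otimes>\<^bsub>product_group UNIV G\<^esub> inv\<^bsub>product_group UNIV G\<^esub> x
        \<in> carrier (product_group UNIV G)"
      using x hc by (intro P.m_closed P.inv_closed)
    ultimately show "x \<otimes>\<^bsub>product_group UNIV G\<^esub> h \<otimes>\<^bsub>product_group UNIV G\<^esub> inv\<^bsub>product_group UNIV G\<^esub> x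
        \<in> ultraproduct_kernel G U"
      using inv[OF x] by (simp add: ultraproduct_kernel_def restrict_def)
  qed
qed

text \<open>
  HOL cannot quantify over types inside a formula, so the type \<open>'g\<close> in which the factor groups
  live is a parameter. It does not bound their size: a sequence of groups living in different
  types can be transported to one common sum type. A theorem that concludes
  \<open>\<not> ui TYPE('g) H\<close> for a type variable \<open>'g\<close> rules out all sequences of groups.
\<close>

definition ui :: "'g itself \<Rightarrow> ('a, 'm) monoid_scheme \<Rightarrow> bool" where
  "ui (T :: 'g itself) H \<longleftrightarrow>
     (\<exists>(G :: nat \<Rightarrow> 'g monoid) U \<phi>. (\<forall>n. group (G n)) \<and> ultrafilter U \<and> nonprincipal U \<and>
        \<phi> \<in> epi (ultraproduct G U) H)"

end

theory Submission
  imports Defs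
begin

text \<open>
  Two features of \<open>H\<close> work against each other. First, a homomorphic image of an ultraproduct over
  \<open>\<nat>\<close> is complete in an algebraic sense (\<open>ui_solves_nested_equations\<close>): for all elements \<open>b\<^sub>j\<close> and
  exponents \<open>q\<^sub>j\<close> it contains a value \<open>h\<^sub>0\<close> of the infinite nested expression
  \[ b_0 (b_1 (b_2 (\cdots)^{q_2})^{q_1})^{q_0}, \]
  because coordinate \<open>n\<close> of the ultraproduct may truncate the expression at depth \<open>n\<close>, and a
  nonprincipal ultrafilter does not see that the depth is finite. The nesting is what makes this
  useful without commutativity: lifts of commuting elements need not commute, so a product of
  many \<open>q\<close>-th powers upstairs need not be a \<open>q\<close>-th power, whereas the tail of the nested expression
  is literally a \<open>q\<^sub>k\<close>-th power. It therefore dies in a quotient of exponent dividing \<open>q\<^sub>k\<close>. If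
  the \<open>b\<^sub>j\<close> commute, what remains there is the finite product
  \<open>b\<^sub>0\<^bsup>w\<^sub>0\<^esup> \<cdots> b\<^sub>k\<^bsup>w\<^sub>k\<^esup>\<close> with \<open>w\<^sub>j = q\<^sub>0 \<cdots> q\<^bsub>j-1\<^esub>\<close>
  (\<open>nested_equations_eq_weighted_prod\<close>).

  Secondly, no power map annihilates the abelian subgroup \<open>A\<close>, and \<open>H\<close> is residually
  bounded torsion. One can therefore choose, stage by stage, an element \<open>a\<^sub>k\<close> of \<open>A\<close> and a normal subgroup
  \<open>L\<^sub>k\<close> with quotient of exponent dividing some \<open>q\<^sub>k \<ge> 1\<close> such that the \<open>(w\<^sub>k k!)\<close>-th power of \<open>a\<^sub>k\<close> lies outside
  \<open>L\<^sub>k\<close>. Applied to sequences with \<open>b\<^sub>k \<in> {1, a\<^sub>k}\<close>, completeness yields an element \<open>h\<close> for each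
  subset of \<open>\<nat>\<close>, controlled modulo every \<open>L\<^sub>k\<close> by the first \<open>k + 1\<close> choices alone. Two consequences
  contradict the two alternatives of the hypothesis.

  Different subsets give different \<open>h\<close>: at the first index \<open>k\<close> where they differ, the two values
  differ modulo \<open>L\<^sub>k\<close> by the \<open>w\<^sub>k\<close>-th power of \<open>a\<^sub>k\<close>. So \<open>H\<close> has at least \<open>2\<^bsup>\<aleph>\<^sub>0\<^esup>\<close> elements.

  Some subset gives an \<open>h\<close> of infinite order: decide at stage \<open>k\<close> whether to include \<open>a\<^sub>k\<close> so that the
  \<open>k!\<close>-th power of the finite product, hence that of \<open>h\<close>, stays outside \<open>L\<^sub>k\<close>. Then no \<open>h\<^bsup>k!\<^esup>\<close> is
  trivial, and every positive integer divides some \<open>k!\<close>. So \<open>H\<close> is not a torsion group.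
\<close>

section \<open>Nested equations in images of ultraproducts\<close>

text \<open>An ultrafilter that contains a singleton is the principal one at that point.\<close>

lemma nonprincipal_ultrafilter_eventually_neq:
  assumes "ultrafilter U" and "nonprincipal U"
  shows "eventually (\<lambda>n. n \<noteq> i) U"
proof (rule ccontr)
  assume "\<not> eventually (\<lambda>n. n \<noteq> i) U"
  then have i: "eventually (\<lambda>n. n = i) U"
    using assms(1) by (force simp: ultrafilter_def)
  have "eventually P U \<longleftrightarrow> P i" for P
  proof
    assume "eventually P U"
    with i have "eventually (\<lambda>n. P i) U"
      by eventually_elim auto
    then show "P i"
      using assms(1) by (cases "P i") (auto simp: ultrafilter_def)
  next
    assume "P i"
    with i show "eventually P U"
      by (auto elim: eventually_mono)
  qed
  then have "U = principal {i}"
    by (simp add: filter_eq_iff eventually_principal)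
  with assms(2) show False
    by (simp add: nonprincipal_def)
qed

lemma nonprincipal_ultrafilter_eventually_gt:
  fixes U :: "nat filter"
  assumes "ultrafilter U" and "nonprincipal U"
  shows "eventually (\<lambda>n. k < n) U"
proof -
  have "eventually (\<lambda>n. \<forall>i\<in>{..k}. n \<noteq> i) U"
    using nonprincipal_ultrafilter_eventually_neq[OF assms]
    by (subst eventually_ball_finite_distrib) auto
  then show ?thesis
    by (rule eventually_mono) (auto simp: not_le)
qed

text \<open>
  The truncation \<open>x\<^sub>j (x\<^bsub>j+1\<^esub> (\<cdots>)\<^bsup>q\<^bsub>j+1\<^esub>\<^esup>)\<^bsup>q\<^sub>j\<^esup>\<close> of the nested expression, \<open>d\<close> levels deep.
\<close>

primrec nested_word ::
  "('a, 'm) monoid_scheme \<Rightarrow> (nat \<Rightarrow> 'a) \<Rightarrow> (nat \<Rightarrow> nat) \<Rightarrow> nat \<Rightarrow> nat \<Rightarrow> 'a" where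
  "nested_word G x q 0 j = \<one>\<^bsub>G\<^esub>"
| "nested_word G x q (Suc d) j = x j \<otimes>\<^bsub>G\<^esub> nested_word G x q d (Suc j) [^]\<^bsub>G\<^esub> q j"

lemma nested_word_closed:
  assumes "monoid G" and "\<And>j. x j \<in> carrier G"
  shows "nested_word G x q d j \<in> carrier G"
proof -
  interpret monoid G by fact
  show ?thesis by (induction d arbitrary: j) (auto simp: assms)
qed

lemma product_group_pow:
  "x [^]\<^bsub>product_group UNIV G\<^esub> (k::nat) = (\<lambda>n. x n [^]\<^bsub>G n\<^esub> k)"
  by (induction k) (simp_all add: nat_pow_def)

text \<open>
  Lift the \<open>b\<^sub>j\<close> to sequences and let \<open>y\<^sub>j\<close> be, at coordinate \<open>n\<close>, the nested expression cut off at
  level \<open>n\<close>. The equation relating \<open>y\<^sub>j\<close> to \<open>y\<^bsub>j+1\<^esub>\<close> then can fail only at the finitely many coordinates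
  \<open>n \<le> j\<close>, hence holds in the ultraproduct.
\<close>

lemma ui_solves_nested_equations:
  fixes H :: "('a, 'm) monoid_scheme" and b :: "nat \<Rightarrow> 'a" and q :: "nat \<Rightarrow> nat"
  assumes H: "group H" and ui: "ui TYPE('g) H" and b: "\<And>j. b j \<in> carrier H"
  obtains h where "\<And>j. h j \<in> carrier H"
    and "\<And>j. h j = b j \<otimes>\<^bsub>H\<^esub> h (Suc j) [^]\<^bsub>H\<^esub> q j"
proof -
  obtain G :: "nat \<Rightarrow> 'g monoid" and U \<phi> where G: "\<And>n. group (G n)"
    and U: "ultrafilter U" "nonprincipal U" and \<phi>: "\<phi> \<in> epi (ultraproduct G U) H"
    using ui unfolding ui_def by blast
  define P where "P = product_group UNIV G"
  define N where "N = ultraproduct_kernel G U"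
  define \<psi> where "\<psi> = (\<lambda>x. \<phi> (N #>\<^bsub>P\<^esub> x))"
  interpret H: group H by fact
  interpret P: group P unfolding P_def using G by simp
  interpret N: normal N P
    unfolding N_def P_def by (rule ultraproduct_kernel_normal[OF G])
  have \<phi>': "\<phi> \<in> epi (P Mod N) H"
    using \<phi> by (simp add: ultraproduct_def P_def N_def)
  have "\<phi> \<circ> (\<lambda>x. N #>\<^bsub>P\<^esub> x) \<in> hom P H"
    using N.r_coset_hom_Mod \<phi>' by (auto simp: epi_def intro: Group.hom_compose)
  then have \<psi>: "\<psi> \<in> hom P H"
    by (simp add: \<psi>_def comp_def)
  interpret \<psi>: group_hom P H \<psi>
    by (unfold_locales) (rule \<psi>)
  have surj: "\<exists>x\<in>carrier P. \<psi> x = c" if "c \<in> carrier H" for c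
  proof -
    have "c \<in> \<phi> ` carrier (P Mod N)"
      using \<phi>' that by (simp add: epi_def)
    then show ?thesis
      by (auto simp: FactGroup_def RCOSETS_def \<psi>_def)
  qed
  have carrP: "x \<in> carrier P \<longleftrightarrow> (\<forall>n. x n \<in> carrier (G n))" for x
    by (auto simp: P_def)
  have \<psi>_cong: "\<psi> x = \<psi> y"
    if x: "x \<in> carrier P" and y: "y \<in> carrier P" and ev: "eventually (\<lambda>n. x n = y n) U" for x y
  proof -
    have iy: "inv\<^bsub>P\<^esub> y = (\<lambda>n. inv\<^bsub>G n\<^esub> y n)"
      using y G unfolding P_def by (simp add: restrict_def)
    have "eventually (\<lambda>n. x n \<otimes>\<^bsub>G n\<^esub> inv\<^bsub>G n\<^esub> y n = \<one>\<^bsub>G n\<^esub>) U"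
      using ev by (rule eventually_mono) (use y carrP G in \<open>auto simp: group.r_inv\<close>)
    moreover have "x \<otimes>\<^bsub>P\<^esub> inv\<^bsub>P\<^esub> y \<in> carrier P"
      using x y by simp
    ultimately have "x \<otimes>\<^bsub>P\<^esub> inv\<^bsub>P\<^esub> y \<in> N"
      using iy unfolding N_def ultraproduct_kernel_def P_def by simp
    then have "N #>\<^bsub>P\<^esub> x = N #>\<^bsub>P\<^esub> y"
      using x y N.rcos_module[OF P.group_axioms y x] P.repr_independence[OF _ y N.subgroup_axioms]
      by simp
    then show ?thesis
      by (simp add: \<psi>_def)
  qed
  obtain x where x: "\<And>j. x j \<in> carrier P" and \<psi>x: "\<And>j. \<psi> (x j) = b j"
    using surj[OF b] by metis
  \<comment> \<open>The depth \<open>n - j\<close> drops by exactly one from \<open>j\<close> to \<open>Suc j\<close> as long as \<open>j < n\<close>.\<close>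
  define y where "y = (\<lambda>j n. nested_word (G n) (\<lambda>i. x i n) q (n - j) j)"
  have y: "y j \<in> carrier P" for j
    unfolding carrP y_def using x G by (auto simp: carrP group.is_monoid intro!: nested_word_closed)
  show thesis
  proof
    show "\<psi> (y j) \<in> carrier H" for j
      using y by simp
    show "\<psi> (y j) = b j \<otimes>\<^bsub>H\<^esub> \<psi> (y (Suc j)) [^]\<^bsub>H\<^esub> q j" for j
    proof -
      have "eventually (\<lambda>n. y j n = (x j \<otimes>\<^bsub>P\<^esub> y (Suc j) [^]\<^bsub>P\<^esub> q j) n) U"
        using nonprincipal_ultrafilter_eventually_gt[OF U, of j]
      proof eventually_elim
        case (elim n)
        then have "n - j = Suc (n - Suc j)"
          by simp
        then show ?case
          by (simp add: y_def P_def product_group_pow)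
      qed
      then have "\<psi> (y j) = \<psi> (x j \<otimes>\<^bsub>P\<^esub> y (Suc j) [^]\<^bsub>P\<^esub> q j)"
        using x y by (intro \<psi>_cong) auto
      also have "\<dots> = b j \<otimes>\<^bsub>H\<^esub> \<psi> (y (Suc j)) [^]\<^bsub>H\<^esub> q j"
        using x y \<psi>x by (simp add: \<psi>.hom_nat_pow)
      finally show ?thesis .
    qed
  qed
qed

section \<open>Nested expressions in groups of finite exponent\<close>

primrec weighted_prod ::
  "('a, 'm) monoid_scheme \<Rightarrow> (nat \<Rightarrow> 'a) \<Rightarrow> (nat \<Rightarrow> nat) \<Rightarrow> nat \<Rightarrow> 'a" where
  "weighted_prod G b w 0 = \<one>\<^bsub>G\<^esub>"
| "weighted_prod G b w (Suc k) = weighted_prod G b w k \<otimes>\<^bsub>G\<^esub> b k [^]\<^bsub>G\<^esub> w k"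

lemma (in group) weighted_prod_in_subgroup:
  assumes "subgroup A G" and "\<And>j. b j \<in> A"
  shows "weighted_prod G b w k \<in> A"
proof (induction k)
  case (Suc k)
  have "b k [^] w k \<in> A"
    using assms by (simp add: subgroup_int_pow_closed flip: int_pow_int)
  with Suc show ?case
    using assms(1) by (simp add: subgroup.m_closed)
qed (use assms in \<open>auto simp: subgroup.one_closed\<close>)

lemma weighted_prod_cong:
  assumes "\<And>j. j < k \<Longrightarrow> b j = c j"
  shows "weighted_prod G b w k = weighted_prod G c w k"
  using assms by (induction k) auto

lemma (in group_hom) hom_weighted_prod:
  assumes "\<And>j. b j \<in> carrier G"
  shows "h (weighted_prod G b w k) = weighted_prod H (\<lambda>j. h (b j)) w k"
proof (induction k)
  case (Suc k)
  have "weighted_prod G b w k \<in> carrier G"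
    using G.weighted_prod_in_subgroup[OF G.subgroup_self] assms by blast
  with Suc assms show ?case
    by (simp add: hom_nat_pow)
qed auto

text \<open>
  When the power at level \<open>k\<close> vanishes, the nested expression becomes finite and can be multiplied
  out. That the \<open>h\<^sub>j\<close> commute with all \<open>b\<^sub>i\<close> is inherited from \<open>h\<^sub>k = b\<^sub>k\<close> down to every \<open>j \<le> k\<close>.
  The brackets are then expanded from the outside: after \<open>j\<close> steps, \<open>h\<^sub>0\<close> is the partial product
  of length \<open>j\<close> times the remaining factor \<open>h\<^sub>j\<^bsup>w\<^sub>j\<^esup>\<close>.
\<close>

lemma (in group) nested_equations_eq_weighted_prod:
  fixes b h :: "nat \<Rightarrow> 'a" and q w :: "nat \<Rightarrow> nat"
  assumes b: "\<And>j. b j \<in> carrier G" and h: "\<And>j. h j \<in> carrier G"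
    and comm: "\<And>i j. b i \<otimes> b j = b j \<otimes> b i"
    and eq: "\<And>j. h j = b j \<otimes> h (Suc j) [^] q j"
    and w: "w 0 = 1" "\<And>j. w (Suc j) = w j * q j"
    and kill: "h (Suc k) [^] q k = \<one>"
  shows "h 0 = weighted_prod G b w (Suc k)"
proof -
  have hk: "h k = b k"
    using eq[of k] kill b by simp
  have commute: "h j \<otimes> b i = b i \<otimes> h j" if "j \<le> k" for i j
    using that
  proof (induction j rule: inc_induct)
    case base
    show ?case by (simp add: hk comm)
  next
    case (step j)
    have "h (Suc j) [^] q j \<otimes> b i = b i \<otimes> h (Suc j) [^] q j"
      by (rule group_commutes_pow[OF step.IH h b])
    then show ?case
      using b h comm[of i j] by (subst (1 2) eq) (metis m_assoc nat_pow_closed)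
  qed
  have closed: "weighted_prod G b w j \<in> carrier G" for j
    using weighted_prod_in_subgroup[OF subgroup_self] b by blast
  have "h 0 = weighted_prod G b w j \<otimes> h j [^] w j" if "j \<le> k" for j
    using that
  proof (induction j)
    case 0
    show ?case using h by (simp add: w)
  next
    case (Suc j)
    have "b j \<otimes> h (Suc j) [^] q j = h (Suc j) [^] q j \<otimes> b j"
      using group_commutes_pow[OF commute[OF Suc.prems] h b] by simp
    then have "(b j \<otimes> h (Suc j) [^] q j) [^] w j
        = b j [^] w j \<otimes> (h (Suc j) [^] q j) [^] w j"
      using b h by (intro pow_mult_distrib) auto
    also have "(h (Suc j) [^] q j) [^] w j = h (Suc j) [^] w (Suc j)"
      using h by (simp add: nat_pow_pow w mult.commute)
    finally have "h j [^] w j = b j [^] w j \<otimes> h (Suc j) [^] w (Suc j)"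
      using eq[of j] by simp
    with Suc closed b h show ?case
      by (simp add: m_assoc)
  qed
  from this[of k] show ?thesis
    by (simp add: hk)
qed

section \<open>Separating sequences\<close>

text \<open>
  The weight \<open>w\<^sub>k\<close> is the product of the exponents of all earlier quotients. It must occur in
  \<open>separated\<close> because \<open>a\<^sub>k\<close> enters the partial products only through its \<open>w\<^sub>k\<close>-th power. The further
  factor \<open>k!\<close> is what allows elements of infinite order to be built.
\<close>

locale separating_sequence = group H + A: subgroup A H
  for H :: "('a, 'm) monoid_scheme" and A +
  fixes a :: "nat \<Rightarrow> 'a" and L :: "nat \<Rightarrow> 'a set" and q w :: "nat \<Rightarrow> nat"
  assumes A_commute: "\<lbrakk>x \<in> A; y \<in> A\<rbrakk> \<Longrightarrow> x \<otimes>\<^bsub>H\<^esub> y = y \<otimes>\<^bsub>H\<^esub> x"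
    and a_in: "a k \<in> A"
    and L_normal: "L k \<lhd> H"
    and exponent: "g \<in> carrier (H Mod L k) \<Longrightarrow> g [^]\<^bsub>H Mod L k\<^esub> q k = \<one>\<^bsub>H Mod L k\<^esub>"
    and w_0: "w 0 = 1" and w_Suc: "w (Suc k) = w k * q k"
    and separated: "a k [^]\<^bsub>H\<^esub> (w k * fact k) \<notin> L k"
begin

text \<open>
  The elements that the partial products of \<open>b\<close> approximate. A limit need not be unique, since
  the intersection of all \<open>L\<^sub>k\<close> may be nontrivial.
\<close>

definition limit :: "(nat \<Rightarrow> 'a) \<Rightarrow> 'a \<Rightarrow> bool" where
  "limit b h \<longleftrightarrow> h \<in> carrier H \<and>
     (\<forall>k. L k #>\<^bsub>H\<^esub> h = L k #>\<^bsub>H\<^esub> weighted_prod H b w (Suc k))"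

definition selection :: "nat set \<Rightarrow> nat \<Rightarrow> 'a" where
  "selection S k = (if k \<in> S then a k else \<one>\<^bsub>H\<^esub>)"

lemma selection_in: "selection S k \<in> A"
  by (simp add: selection_def a_in)

lemma weighted_prod_in_A:
  assumes "\<And>j. b j \<in> A"
  shows "weighted_prod H b w k \<in> A"
  using weighted_prod_in_subgroup[OF A.subgroup_axioms assms] .

lemma quotient_map_hom: "group_hom H (H Mod L k) (\<lambda>x. L k #>\<^bsub>H\<^esub> x)"
  using normal.r_coset_hom_Mod[OF L_normal] normal.factorgroup_is_group[OF L_normal]
  by (simp add: group_hom_def group_hom_axioms_def group_axioms)

lemma quotient_map_eq_one_iff:
  assumes "x \<in> carrier H"
  shows "L k #>\<^bsub>H\<^esub> x = \<one>\<^bsub>H Mod L k\<^esub> \<longleftrightarrow> x \<in> L k"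
  unfolding FactGroup_def
  using coset_join1[OF _ assms normal_imp_subgroup[OF L_normal]]
    coset_join2[OF assms normal_imp_subgroup[OF L_normal]] by auto

text \<open>
  The same solution of the nested equations serves all \<open>k\<close> at once: its image modulo \<open>L\<^sub>k\<close> loses
  the tail \<open>h\<^bsub>k+1\<^esub>\<^bsup>q\<^sub>k\<^esup>\<close>.
\<close>

lemma limit_exists:
  assumes ui: "ui TYPE('g) H" and b: "\<And>j. b j \<in> A"
  shows "\<exists>h. limit b h"
proof -
  have bH: "b j \<in> carrier H" for j
    using b by simp
  obtain h where h: "\<And>j. h j \<in> carrier H"
    and eq: "\<And>j. h j = b j \<otimes>\<^bsub>H\<^esub> h (Suc j) [^]\<^bsub>H\<^esub> q j"
    using ui_solves_nested_equations[OF group_axioms ui, of b q] bH by blast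
  have "L k #>\<^bsub>H\<^esub> h 0 = L k #>\<^bsub>H\<^esub> weighted_prod H b w (Suc k)" for k
  proof -
    interpret \<pi>: group_hom H "H Mod L k" "\<lambda>x. L k #>\<^bsub>H\<^esub> x" by (rule quotient_map_hom)
    have "L k #>\<^bsub>H\<^esub> h 0 = weighted_prod (H Mod L k) (\<lambda>j. L k #>\<^bsub>H\<^esub> b j) w (Suc k)"
    proof (rule \<pi>.H.nested_equations_eq_weighted_prod
        [where h = "\<lambda>j. L k #>\<^bsub>H\<^esub> h j", OF _ _ _ _ w_0 w_Suc])
      show "(L k #>\<^bsub>H\<^esub> b i) \<otimes>\<^bsub>H Mod L k\<^esub> (L k #>\<^bsub>H\<^esub> b j)
          = (L k #>\<^bsub>H\<^esub> b j) \<otimes>\<^bsub>H Mod L k\<^esub> (L k #>\<^bsub>H\<^esub> b i)" for i j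
        using A_commute[OF b[of i] b[of j]] bH by (metis \<pi>.hom_mult)
      show "L k #>\<^bsub>H\<^esub> h j
          = (L k #>\<^bsub>H\<^esub> b j) \<otimes>\<^bsub>H Mod L k\<^esub> (L k #>\<^bsub>H\<^esub> h (Suc j)) [^]\<^bsub>H Mod L k\<^esub> q j" for j
        using bH h by (subst eq) (metis \<pi>.hom_mult \<pi>.hom_nat_pow nat_pow_closed)
      show "(L k #>\<^bsub>H\<^esub> h (Suc k)) [^]\<^bsub>H Mod L k\<^esub> q k = \<one>\<^bsub>H Mod L k\<^esub>"
        by (rule exponent) (rule \<pi>.hom_closed[OF h])
    qed (use bH h \<pi>.hom_closed in blast)+
    also have "\<dots> = L k #>\<^bsub>H\<^esub> weighted_prod H b w (Suc k)"
      by (rule \<pi>.hom_weighted_prod[symmetric]) (rule bH)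
    finally show ?thesis .
  qed
  with h have "limit b (h 0)"
    by (simp add: limit_def del: weighted_prod.simps)
  then show ?thesis ..
qed

text \<open>
  At the first index \<open>k\<close> in which \<open>S\<close> and \<open>T\<close> differ, the partial products differ by the factor
  \<open>a\<^sub>k\<^bsup>w\<^sub>k\<^esup>\<close>, and this is visible modulo \<open>L\<^sub>k\<close>, where all later factors have disappeared.
\<close>

lemma selection_determined_by_limit:
  assumes S: "limit (selection S) h" and T: "limit (selection T) h"
  shows "S = T"
proof (rule ccontr)
  assume "S \<noteq> T"
  then have ex: "\<exists>k. k \<in> S \<longleftrightarrow> k \<notin> T" by auto
  define k where "k = (LEAST k. k \<in> S \<longleftrightarrow> k \<notin> T)"
  have k: "k \<in> S \<longleftrightarrow> k \<notin> T"
    unfolding k_def using ex by (rule LeastI_ex)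
  have before: "j \<in> S \<longleftrightarrow> j \<in> T" if "j < k" for j
    using not_less_Least[of j "\<lambda>k. k \<in> S \<longleftrightarrow> k \<notin> T"] that unfolding k_def by blast
  interpret \<pi>: group_hom H "H Mod L k" "\<lambda>x. L k #>\<^bsub>H\<^esub> x" by (rule quotient_map_hom)
  define c where "c = weighted_prod H (selection S) w k"
  have c: "c \<in> carrier H"
    unfolding c_def using weighted_prod_in_A[OF selection_in] by simp
  have "weighted_prod H (selection T) w k = c"
    unfolding c_def by (rule weighted_prod_cong) (simp add: selection_def before)
  then have "L k #>\<^bsub>H\<^esub> (c \<otimes>\<^bsub>H\<^esub> selection S k [^]\<^bsub>H\<^esub> w k)
      = L k #>\<^bsub>H\<^esub> (c \<otimes>\<^bsub>H\<^esub> selection T k [^]\<^bsub>H\<^esub> w k)"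
    using S T unfolding limit_def c_def weighted_prod.simps by metis
  then have "L k #>\<^bsub>H\<^esub> (selection S k [^]\<^bsub>H\<^esub> w k) = L k #>\<^bsub>H\<^esub> (selection T k [^]\<^bsub>H\<^esub> w k)"
    using c selection_in[of S k] selection_in[of T k]
    by (metis A.mem_carrier nat_pow_closed \<pi>.H.l_cancel \<pi>.hom_closed \<pi>.hom_mult)
  then have "L k #>\<^bsub>H\<^esub> (a k [^]\<^bsub>H\<^esub> w k) = \<one>\<^bsub>H Mod L k\<^esub>"
    using k \<pi>.hom_one by (cases "k \<in> S") (simp_all add: selection_def)
  then have "L k #>\<^bsub>H\<^esub> ((a k [^]\<^bsub>H\<^esub> w k) [^]\<^bsub>H\<^esub> (fact k :: nat)) = \<one>\<^bsub>H Mod L k\<^esub>"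
    using a_in[of k] by (metis A.mem_carrier nat_pow_closed \<pi>.H.nat_pow_one \<pi>.hom_nat_pow)
  then show False
    using separated[of k] a_in[of k] quotient_map_eq_one_iff by (simp add: nat_pow_pow)
qed

text \<open>
  A greedy choice: include \<open>a\<^sub>k\<close> exactly if the \<open>k!\<close>-th power of the partial product so far
  lies in \<open>L\<^sub>k\<close>. In that case the new \<open>k!\<close>-th power is an element of \<open>L\<^sub>k\<close> times \<open>a\<^sub>k\<^bsup>w\<^sub>k k!\<^esup>\<close>,
  which is outside \<open>L\<^sub>k\<close>.
\<close>

lemma greedy_selection_exists:
  "\<exists>S. \<forall>k. weighted_prod H (selection S) w (Suc k) [^]\<^bsub>H\<^esub> (fact k :: nat) \<notin> L k"
proof -
  define p where "p = rec_nat \<one>\<^bsub>H\<^esub> (\<lambda>k x. if x [^]\<^bsub>H\<^esub> (fact k :: nat) \<in> L k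
      then x \<otimes>\<^bsub>H\<^esub> a k [^]\<^bsub>H\<^esub> w k else x)"
  have p_Suc: "p (Suc k) = (if p k [^]\<^bsub>H\<^esub> (fact k :: nat) \<in> L k
      then p k \<otimes>\<^bsub>H\<^esub> a k [^]\<^bsub>H\<^esub> w k else p k)" for k
    by (simp add: p_def)
  define S where "S = {k. p k [^]\<^bsub>H\<^esub> (fact k :: nat) \<in> L k}"
  have prod_in: "weighted_prod H (selection S) w k \<in> A" for k
    by (rule weighted_prod_in_A[OF selection_in])
  have p: "p k = weighted_prod H (selection S) w k" for k
  proof (induction k)
    case (Suc k)
    have "p k \<in> carrier H"
      using Suc prod_in[of k] by simp
    then have "p (Suc k) = p k \<otimes>\<^bsub>H\<^esub> selection S k [^]\<^bsub>H\<^esub> w k"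
      by (simp add: p_Suc selection_def S_def)
    with Suc show ?case by simp
  qed (simp add: p_def)
  have p_in: "p k \<in> A" for k
    by (simp add: p prod_in)
  have "p (Suc k) [^]\<^bsub>H\<^esub> (fact k :: nat) \<notin> L k" for k
  proof (cases "p k [^]\<^bsub>H\<^esub> (fact k :: nat) \<in> L k")
    case True
    have "p k \<otimes>\<^bsub>H\<^esub> a k [^]\<^bsub>H\<^esub> w k = a k [^]\<^bsub>H\<^esub> w k \<otimes>\<^bsub>H\<^esub> p k"
      using p_in[of k] a_in[of k] by (intro group_commutes_pow[symmetric] A_commute) auto
    then have "(p k \<otimes>\<^bsub>H\<^esub> a k [^]\<^bsub>H\<^esub> w k) [^]\<^bsub>H\<^esub> (fact k :: nat)
        = p k [^]\<^bsub>H\<^esub> (fact k :: nat) \<otimes>\<^bsub>H\<^esub> (a k [^]\<^bsub>H\<^esub> w k) [^]\<^bsub>H\<^esub> (fact k :: nat)"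
      using p_in[of k] a_in[of k] by (intro pow_mult_distrib) auto
    moreover have "p k [^]\<^bsub>H\<^esub> (fact k :: nat) \<otimes>\<^bsub>H\<^esub> a k [^]\<^bsub>H\<^esub> (w k * fact k) \<notin> L k"
    proof
      assume *: "p k [^]\<^bsub>H\<^esub> (fact k :: nat) \<otimes>\<^bsub>H\<^esub> a k [^]\<^bsub>H\<^esub> (w k * fact k) \<in> L k"
      interpret L: subgroup "L k" H
        by (rule normal_imp_subgroup[OF L_normal])
      have "inv\<^bsub>H\<^esub> (p k [^]\<^bsub>H\<^esub> (fact k :: nat)) \<otimes>\<^bsub>H\<^esub>
          (p k [^]\<^bsub>H\<^esub> (fact k :: nat) \<otimes>\<^bsub>H\<^esub> a k [^]\<^bsub>H\<^esub> (w k * fact k)) \<in> L k"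
        using True * by blast
      then show False
        using separated[of k] p_in[of k] a_in[of k] by (simp add: m_assoc[symmetric])
    qed
    ultimately show ?thesis
      using True a_in[of k] by (simp add: p_Suc nat_pow_pow)
  qed (simp add: p_Suc)
  then show ?thesis
    unfolding p by blast
qed

text \<open>
  If \<open>h\<close> had order dividing \<open>n\<close>, then \<open>h\<^bsup>n!\<^esup>\<close> would be trivial. Modulo \<open>L\<^sub>n\<close>, this power is that of a partial
  product, which is nontrivial.
\<close>

lemma limit_infinite_order:
  fixes n :: nat
  assumes lim: "limit b h" and b: "\<And>j. b j \<in> A"
    and avoid: "\<And>k. weighted_prod H b w (Suc k) [^]\<^bsub>H\<^esub> (fact k :: nat) \<notin> L k"
    and n: "n \<ge> 1"
  shows "h [^]\<^bsub>H\<^esub> n \<noteq> \<one>\<^bsub>H\<^esub>"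
proof
  assume hn: "h [^]\<^bsub>H\<^esub> n = \<one>\<^bsub>H\<^esub>"
  have h: "h \<in> carrier H"
    using lim by (simp add: limit_def)
  define c where "c = weighted_prod H b w (Suc n)"
  have c: "c \<in> carrier H"
    unfolding c_def by (rule A.mem_carrier[OF weighted_prod_in_A[OF b]])
  have hc: "L n #>\<^bsub>H\<^esub> h = L n #>\<^bsub>H\<^esub> c"
    using lim unfolding limit_def c_def by blast
  interpret \<pi>: group_hom H "H Mod L n" "\<lambda>x. L n #>\<^bsub>H\<^esub> x"
    by (rule quotient_map_hom)
  obtain m where m: "(fact n :: nat) = n * m"
    using n by (metis dvdE dvd_fact order_refl)
  have "h [^]\<^bsub>H\<^esub> (fact n :: nat) = (h [^]\<^bsub>H\<^esub> n) [^]\<^bsub>H\<^esub> m"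
    unfolding m using h by (simp add: nat_pow_pow)
  then have h_fact: "h [^]\<^bsub>H\<^esub> (fact n :: nat) = \<one>\<^bsub>H\<^esub>"
    by (simp add: hn)
  have "L n #>\<^bsub>H\<^esub> (c [^]\<^bsub>H\<^esub> (fact n :: nat)) = (L n #>\<^bsub>H\<^esub> c) [^]\<^bsub>H Mod L n\<^esub> (fact n :: nat)"
    by (rule \<pi>.hom_nat_pow[OF c])
  also have "\<dots> = (L n #>\<^bsub>H\<^esub> h) [^]\<^bsub>H Mod L n\<^esub> (fact n :: nat)"
    unfolding hc ..
  also have "\<dots> = L n #>\<^bsub>H\<^esub> (h [^]\<^bsub>H\<^esub> (fact n :: nat))"
    by (rule \<pi>.hom_nat_pow[OF h, symmetric])
  also have "\<dots> = \<one>\<^bsub>H Mod L n\<^esub>"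
    unfolding h_fact by (rule \<pi>.hom_one)
  finally have "c [^]\<^bsub>H\<^esub> (fact n :: nat) \<in> L n"
    using quotient_map_eq_one_iff[OF nat_pow_closed[OF c]] by blast
  then show False
    using avoid[of n] unfolding c_def by contradiction
qed

end

lemma residually_bounded_torsion_separates_power:
  fixes H :: "('a, 'm) monoid_scheme" and M :: nat
  assumes "group H" and res: "residually_bounded_torsion H" and A: "subgroup A H"
    and unb: "\<not> bounded_torsion (H\<lparr>carrier := A\<rparr>)" and M: "M \<ge> 1"
  shows "\<exists>a L m. a \<in> A \<and> L \<lhd> H \<and> m \<ge> 1 \<and>
     (\<forall>g\<in>carrier (H Mod L). g [^]\<^bsub>H Mod L\<^esub> (m::nat) = \<one>\<^bsub>H Mod L\<^esub>) \<and>
     a [^]\<^bsub>H\<^esub> M \<notin> L"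
proof -
  interpret group H by fact
  obtain a where a: "a \<in> A" "a [^]\<^bsub>H\<^esub> M \<noteq> \<one>\<^bsub>H\<^esub>"
    using unb M unfolding bounded_torsion_def by (auto simp flip: nat_pow_consistent)
  then have "a [^]\<^bsub>H\<^esub> M \<in> carrier H - {\<one>\<^bsub>H\<^esub>}"
    using subgroup.mem_carrier[OF A] by simp
  with res a(1) show ?thesis
    unfolding residually_bounded_torsion_def bounded_torsion_def by meson
qed

lemma separating_sequence_exists:
  fixes H :: "('a, 'm) monoid_scheme"
  assumes "group H" and "residually_bounded_torsion H" and "subgroup A H"
    and comm: "comm_group (H\<lparr>carrier := A\<rparr>)"
    and "\<not> bounded_torsion (H\<lparr>carrier := A\<rparr>)"
  shows "\<exists>a L q w. separating_sequence H A a L q w"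
proof -
  interpret group H by fact
  interpret A: subgroup A H by fact
  obtain \<alpha> \<Lambda> \<mu> where sep: "\<And>M::nat. M \<ge> 1 \<Longrightarrow> \<alpha> M \<in> A \<and> \<Lambda> M \<lhd> H \<and> \<mu> M \<ge> 1 \<and>
      (\<forall>g\<in>carrier (H Mod \<Lambda> M). g [^]\<^bsub>H Mod \<Lambda> M\<^esub> (\<mu> M :: nat) = \<one>\<^bsub>H Mod \<Lambda> M\<^esub>) \<and>
      \<alpha> M [^]\<^bsub>H\<^esub> M \<notin> \<Lambda> M"
    using residually_bounded_torsion_separates_power[OF assms(1,2,3,5)] by metis
  \<comment> \<open>The data at stage \<open>k\<close> depend on the earlier stages only through the number \<open>w k * fact k\<close>, so
    with \<open>\<alpha>\<close>, \<open>\<Lambda>\<close>, \<open>\<mu>\<close> chosen once as functions of that number, a recursion on \<open>w\<close> alone suffices.\<close>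
  define w :: "nat \<Rightarrow> nat" where "w = rec_nat 1 (\<lambda>k v. v * \<mu> (v * fact k))"
  define a where "a k = \<alpha> (w k * fact k)" for k
  define L where "L k = \<Lambda> (w k * fact k)" for k
  define q where "q k = \<mu> (w k * fact k)" for k
  have w: "w 0 = 1" "w (Suc k) = w k * q k" for k
    by (simp_all add: w_def q_def)
  have w_fact: "w k * fact k \<ge> 1" for k
  proof -
    have "w k \<ge> 1"
    proof (induction k)
      case (Suc k)
      have "w k * fact k \<ge> 1"
        using Suc by (simp add: Suc_le_eq)
      from sep[OF this] Suc show ?case
        by (simp add: w q_def Suc_le_eq)
    qed (simp add: w)
    then show ?thesis
      by (simp add: Suc_le_eq)
  qed
  have "separating_sequence H A a L q w"
  proof (intro separating_sequence.intro separating_sequence_axioms.intro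
      group_axioms A.subgroup_axioms w)
    show "x \<otimes>\<^bsub>H\<^esub> y = y \<otimes>\<^bsub>H\<^esub> x" if "x \<in> A" "y \<in> A" for x y
      using comm_monoid.m_comm[OF comm_group.axioms(1)[OF comm], of x y] that by simp
  qed (use sep[OF w_fact] in \<open>simp_all add: a_def L_def q_def\<close>)
  then show ?thesis
    by blast
qed

theorem corollary18:
  fixes H :: "('a, 'm) monoid_scheme" and A :: "'a set"
  assumes "group H"
    and "residually_bounded_torsion H"
    and "subgroup A H"
    and "comm_group (H\<lparr>carrier := A\<rparr>)"
    and "\<not> bounded_torsion (H\<lparr>carrier := A\<rparr>)"
    and "torsion H \<or> carrier H \<prec> (UNIV :: nat set set)"
  shows "\<not> ui TYPE('g) H"
proof
  assume ui: "ui TYPE('g) H"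
  obtain a L q w where "separating_sequence H A a L q w"
    using separating_sequence_exists[OF assms(1-5)] by blast
  then interpret separating_sequence H A a L q w .
  have "\<exists>h. limit (selection S) h" for S
    by (rule limit_exists[OF ui]) (rule selection_in)
  then obtain h where h: "\<And>S. limit (selection S) (h S)"
    by metis
  have h_closed: "h S \<in> carrier H" for S
    using h[of S] by (simp add: limit_def)
  from assms(6) show False
  proof
    assume "torsion H"
    obtain S where S: "\<And>k. weighted_prod H (selection S) w (Suc k) [^]\<^bsub>H\<^esub> (fact k :: nat) \<notin> L k"
      using greedy_selection_exists by blast
    have "h S [^]\<^bsub>H\<^esub> n \<noteq> \<one>\<^bsub>H\<^esub>" if "n \<ge> 1" for n :: nat
      by (rule limit_infinite_order[OF h selection_in S that])
    with \<open>torsion H\<close> h_closed[of S] show False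
      unfolding torsion_def by blast
  next
    assume small: "carrier H \<prec> (UNIV :: nat set set)"
    have "inj h"
    proof (rule injI)
      fix S T assume "h S = h T"
      then show "S = T"
        using selection_determined_by_limit[of S "h S" T] h[of S] h[of T] by simp
    qed
    then have "(UNIV :: nat set set) \<lesssim> carrier H"
      unfolding lepoll_def using h_closed by blast
    then have "carrier H \<approx> (UNIV :: nat set set)"
      using small by (intro lepoll_antisym) (simp_all add: lesspoll_def)
    with small show False
      by (simp add: lesspoll_def)
  qed
qed

end
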